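(* Let $d \ge 1$ and let $\Omega \subset \mathbb{R}^d$ be open and bounded. Let $h : [0,\infty) \to [0,\infty)$ be a function such that: (i) $h \in C([0,\infty)) \cap C^2(0,\infty)$; (ii) $h''(\lambda) > 0$ for every $\lambda > 0$; (iii) $\dfrac{h(\lambda)}{\lambda} \to \infty$ as $\lambda \to \infty$; (iv) there is a constant $c > 0$ such that $c\lambda - c \le h(\lambda)$ for every $\lambda \ge 0$. Let $\{u_n\}_{n\in\mathbb{N}} \subseteq L^1(\Omega)$ and $u \in L^\infty(\Omega)$ be nonnegative real-valued functions. Suppose that $Dh(u) \in L^\infty(\Omega)$, that $$\sup_n \int_\Omega h(u_n)\, dx < \infty,$$ and that $$\int_\Omega h(u_n | u)\, dx \to 0 \quad \text{as } n \to \infty .$$ Then $\{u_n\}$ converges to $u$ in $L^1(\Omega)$.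
   Context: Here $Dh = h'$ denotes the derivative of $h$ on $(0,\infty)$; at $0$, $Dh(0)$ denotes the right derivative $\lim_{\lambda \to 0^+} (h(\lambda)-h(0))/\lambda \in [-\infty,\infty)$, which exists by convexity. The hypothesis $Dh(u) \in L^\infty(\Omega)$ means that $x \mapsto Dh(u(x))$ is finite almost everywhere and essentially bounded (so if $Dh(0) = -\infty$, then $u > 0$ a.e.). The relative entropy is defined by $$h(v | u) = h(v) - h(u) - Dh(u)\,(v - u)$$ for $v \ge 0$ and $u \ge 0$ with $Dh(u)$ finite, and for functions $v,u$ on $\Omega$, $h(v|u)$ denotes the function $x \mapsto h(v(x)|u(x))$. *)

theory Defs
  imports "HOL-Analysis.Analysis"
begin

definition C2_on :: "real set \<Rightarrow> (real \<Rightarrow> real) \<Rightarrow> bool" where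
  "C2_on S h \<longleftrightarrow>
     (\<forall>x\<in>S. h differentiable (at x)) \<and>
     (\<forall>x\<in>S. deriv h differentiable (at x)) \<and>
     continuous_on S (deriv (deriv h))"

text \<open>Membership in \<open>L\<^sup>\<infinity>(M)\<close> for extended-real functions. A bound by a real
  constant almost everywhere forces the function to be finite almost everywhere.\<close>

definition Linfty :: "'a measure \<Rightarrow> ('a \<Rightarrow> ereal) \<Rightarrow> bool" where
  "Linfty M f \<longleftrightarrow>
     f \<in> borel_measurable M \<and> (\<exists>C::real. AE x in M. \<bar>f x\<bar> \<le> ereal C)"

text \<open>At \<open>0\<close> this is the right derivative, possibly \<open>-\<infinity>\<close>; the limit is taken in
  the extended reals, where it exists if \<open>h\<close> is convex on \<open>[0,\<infinity>)\<close>. Only values at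
  nonnegative arguments are meaningful.\<close>

definition Dh :: "(real \<Rightarrow> real) \<Rightarrow> real \<Rightarrow> ereal" where
  "Dh h x = (if x = 0 then Lim (at_right 0) (\<lambda>t. ereal ((h t - h 0) / t))
             else ereal (deriv h x))"

text \<open>\<open>rel_entropy h v u\<close> is \<open>h(v | u)\<close>. It is meaningful only if \<open>Dh h u\<close> is finite,
  since \<open>real_of_ereal\<close> maps the infinities to \<open>0\<close>.\<close>

definition rel_entropy :: "(real \<Rightarrow> real) \<Rightarrow> real \<Rightarrow> real \<Rightarrow> real" where
  "rel_entropy h v u = h v - h u - real_of_ereal (Dh h u) * (v - u)"

end

theory Submission
  imports Defs
begin

text \<open>Convexity upgrades the relative entropy to a bound \<open>\<bar>v - u\<bar> \<le> \<epsilon> + A h(v | u)\<close>, in which \<open>A\<close>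
  depends only on \<open>\<epsilon>\<close> and on an upper bound for \<open>u\<close>: stepping \<open>\<epsilon>/2\<close> away from \<open>u\<close> towards \<open>v\<close>, the
  slope of \<open>h\<close> has changed by a definite amount, because \<open>h''\<close> is bounded below on compact subsets of
  \<open>(0,\<infinity>)\<close>. Integrating this bound over the finite measure space \<open>\<Omega>\<close> and letting first \<open>n \<rightarrow> \<infinity>\<close> and
  then \<open>\<epsilon> \<rightarrow> 0\<close> gives the claim.\<close>

section \<open>Complete measure spaces\<close>

text \<open>Preimages under \<open>f\<close> and \<open>g\<close> differ only inside a null set, and
  completeness makes such a difference measurable.\<close>

lemma (in complete_measure) measurable_AE_eq:
  assumes f: "f \<in> M \<rightarrow>\<^sub>M N" and g: "g \<in> space M \<rightarrow> space N" and eq: "AE x in M. f x = g x"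
  shows "g \<in> M \<rightarrow>\<^sub>M N"
proof (rule measurableI)
  fix A assume "A \<in> sets N"
  show "g -` A \<inter> space M \<in> sets M"
  proof (rule in_sets_AE)
    show "f -` A \<inter> space M \<in> sets M"
      using f \<open>A \<in> sets N\<close> by (rule measurable_sets)
    show "AE x in M. x \<in> f -` A \<inter> space M \<longleftrightarrow> x \<in> g -` A \<inter> space M"
      using eq by eventually_elim auto
  qed simp
qed (use g in auto)

text \<open>Needed for \<open>lebesgue_on \<Omega>\<close>: null sets of the restriction are the
  null sets of \<open>M\<close> inside \<open>S\<close>, so completeness is inherited.\<close>

lemma (in complete_measure) complete_measure_restrict_space:
  assumes "S \<in> sets M"
  shows "complete_measure (restrict_space M S)"
proof
  fix A B assume "B \<subseteq> A" "A \<in> null_sets (restrict_space M S)"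
  then have "A \<subseteq> S" "A \<in> null_sets M"
    using assms by (auto simp: null_sets_restrict_space)
  then show "B \<in> sets (restrict_space M S)"
    using complete[OF \<open>B \<subseteq> A\<close>] \<open>B \<subseteq> A\<close> assms by (auto simp: sets_restrict_space_iff)
qed

section \<open>Convexity of \<open>h\<close> up to the boundary point 0\<close>

locale entropy =
  fixes h :: "real \<Rightarrow> real"
  assumes cont: "continuous_on {0..} h"
    and C2: "C2_on {0<..} h"
    and deriv2_pos: "\<And>x. 0 < x \<Longrightarrow> 0 < deriv (deriv h) x"
begin

lemma deriv_h: "0 < x \<Longrightarrow> (h has_real_derivative deriv h x) (at x)"
  using C2 by (auto simp: C2_on_def DERIV_deriv_iff_real_differentiable)

lemma deriv2_h: "0 < x \<Longrightarrow> (deriv h has_real_derivative deriv (deriv h) x) (at x)"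
  using C2 by (auto simp: C2_on_def DERIV_deriv_iff_real_differentiable)

lemma deriv_mono:
  assumes "0 < x" "x \<le> y"
  shows "deriv h x \<le> deriv h y"
  by (rule DERIV_nonneg_imp_nondecreasing[OF \<open>x \<le> y\<close>])
     (meson assms(1) deriv2_h deriv2_pos less_eq_real_def less_le_trans)

text \<open>The mean value theorem asks for differentiability only inside the interval, so
  \<open>a = 0\<close> is allowed although \<open>h\<close> is merely continuous there.\<close>

lemma secant_mvt:
  assumes "0 \<le> a" "a < b"
  obtains z where "a < z" "z < b" "h b - h a = (b - a) * deriv h z"
proof -
  have "continuous_on {a..b} h"
    using cont by (rule continuous_on_subset) (use assms in auto)
  moreover have "h differentiable (at x)" if "a < x" for x
    using deriv_h[of x] that assms real_differentiable_def by force
  ultimately obtain l z where z: "a < z" "z < b" "(h has_real_derivative l) (at z)"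
      "h b - h a = (b - a) * l"
    using MVT[OF \<open>a < b\<close>, of h] by blast
  moreover have "l = deriv h z"
    using z(3) by (simp add: DERIV_imp_deriv)
  ultimately show thesis
    using that by blast
qed

text \<open>The secant between \<open>v\<close> and \<open>w\<close> has the slope of
  \<open>h\<close> at an intermediate point, which monotonicity of \<open>deriv h\<close> compares
  with the slope at \<open>w\<close>.\<close>

lemma tangent_le:
  assumes "0 < w" "0 \<le> v"
  shows "h w + deriv h w * (v - w) \<le> h v"
proof (cases v w rule: linorder_cases)
  case less
  obtain z where z: "v < z" "z < w" "h w - h v = (w - v) * deriv h z"
    using secant_mvt[OF \<open>0 \<le> v\<close> less] by blast
  have "(w - v) * deriv h z \<le> (w - v) * deriv h w"
    using z less assms by (intro mult_left_mono deriv_mono) auto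
  with z(3) show ?thesis by (simp add: algebra_simps)
next
  case greater
  obtain z where z: "w < z" "z < v" "h v - h w = (v - w) * deriv h z"
    using secant_mvt[OF less_imp_le[OF \<open>0 < w\<close>] greater] by blast
  have "(v - w) * deriv h w \<le> (v - w) * deriv h z"
    using z greater assms by (intro mult_left_mono deriv_mono) auto
  with z(3) show ?thesis by (simp add: algebra_simps)
qed simp

text \<open>The tangent at \<open>s\<close>, evaluated at 0 and at \<open>t\<close>, separates the
  slope of the secant over [0, s] from that over [s, t]; the slope over [0, t] is a weighted average
  of the two.\<close>

lemma secant_at_0_mono:
  assumes "0 < s" "s \<le> t"
  shows "(h s - h 0) / s \<le> (h t - h 0) / t"
proof -
  have 1: "h s + deriv h s * (0 - s) \<le> h 0" and 2: "h s + deriv h s * (t - s) \<le> h t"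
    using assms tangent_le[of s 0] tangent_le[of s t] by auto
  have "(h s - h 0) * (t - s) \<le> (deriv h s * s) * (t - s)"
    using 1 assms by (intro mult_right_mono) auto
  also have "\<dots> = (deriv h s * (t - s)) * s" by simp
  also have "\<dots> \<le> (h t - h s) * s"
    using 2 assms by (intro mult_right_mono) auto
  finally show ?thesis
    using assms by (simp add: field_simps)
qed

text \<open>Monotone difference quotients converge at 0 from the right to their infimum, possibly
  -\<infinity>. Only this convergence identifies the \<open>Lim\<close> in \<open>Dh\<close> with
  the infimum.\<close>

lemma Dh_0_le:
  assumes "0 < t"
  shows "Dh h 0 \<le> ereal ((h t - h 0) / t)"
proof -
  define q where "q = (\<lambda>t. ereal ((h t - h 0) / t))"
  define L where "L = (INF t\<in>{0<..}. q t)"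
  have "(q \<longlongrightarrow> L) (at_right 0)"
  proof (rule order_tendstoI)
    fix a assume a: "a < L"
    have "a < q t" if "0 < t" for t
      using a that unfolding L_def by (metis INF_lower greaterThan_iff less_le_trans)
    then show "\<forall>\<^sub>F t in at_right 0. a < q t"
      by (auto intro: eventually_mono[OF eventually_at_right_less])
  next
    fix a assume "L < a"
    then obtain s where s: "0 < s" "q s < a"
      unfolding L_def by (auto simp: INF_less_iff)
    have "q t < a" if "0 < t" "t < s" for t
      using s secant_at_0_mono[of t s] that unfolding q_def
      by (metis ereal_less_eq(3) le_less_trans less_imp_le)
    then show "\<forall>\<^sub>F t in at_right 0. q t < a"
      using s(1) by (auto simp: eventually_at_right[OF zero_less_one])
  qed
  then have "Dh h 0 = L"
    by (simp add: Dh_def q_def tendsto_Lim)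
  also have "\<dots> \<le> q t"
    unfolding L_def using assms by (intro INF_lower) simp
  finally show ?thesis by (simp add: q_def)
qed

text \<open>Extends the tangent inequality to \<open>u = 0\<close>. Finiteness excludes slope
  -\<infinity> there, which \<open>real_of_ereal\<close> would turn into 0.\<close>

lemma Dh_subgradient:
  assumes "0 \<le> u" "\<bar>Dh h u\<bar> \<noteq> \<infinity>" "0 \<le> v"
  shows "h u + real_of_ereal (Dh h u) * (v - u) \<le> h v"
proof (cases "u = 0")
  case False
  then show ?thesis
    using tangent_le[of u v] assms by (simp add: Dh_def)
next
  case True
  show ?thesis
  proof (cases "v = 0")
    case False
    obtain D where D: "Dh h 0 = ereal D"
      using assms(2) True by auto
    have "D \<le> (h v - h 0) / v"
      using Dh_0_le[of v] D False assms by simp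
    then show ?thesis
      using True D False assms by (simp add: field_simps)
  qed (use True in simp)
qed

lemma rel_entropy_nonneg:
  assumes "0 \<le> u" "\<bar>Dh h u\<bar> \<noteq> \<infinity>" "0 \<le> v"
  shows "0 \<le> rel_entropy h v u"
  using Dh_subgradient[OF assms] by (simp add: rel_entropy_def)

text \<open>Monotonicity of the slope including \<open>u = 0\<close>: add the supporting line at
  \<open>u\<close>, evaluated at \<open>t\<close>, to the one at \<open>t\<close>, evaluated at
  \<open>u\<close>.\<close>

lemma Dh_le_deriv:
  assumes "0 \<le> u" "\<bar>Dh h u\<bar> \<noteq> \<infinity>" "u < t"
  shows "real_of_ereal (Dh h u) \<le> deriv h t"
proof -
  have "h u + real_of_ereal (Dh h u) * (t - u) \<le> h t"
    using assms by (intro Dh_subgradient) auto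
  moreover have "h t + deriv h t * (u - t) \<le> h u"
    using assms by (intro tangent_le) auto
  ultimately have "real_of_ereal (Dh h u) * (t - u) \<le> deriv h t * (t - u)"
    by (simp add: algebra_simps)
  then show ?thesis using assms by simp
qed

section \<open>Quantitative convexity\<close>

text \<open>The constant \<open>m\<close> is the minimum of the second derivative on the compact
  interval [a, b]; \<open>a\<close> stays positive because the second derivative may degenerate at
  0.\<close>

lemma deriv_strongly_mono:
  assumes "0 < a"
  obtains m where "0 < m"
    "\<And>x y. a \<le> x \<Longrightarrow> x \<le> y \<Longrightarrow> y \<le> b \<Longrightarrow> m * (y - x) \<le> deriv h y - deriv h x"
proof (cases "a \<le> b")
  case True
  have "continuous_on {a..b} (deriv (deriv h))"
    using C2 unfolding C2_on_def
    by (auto intro: continuous_on_subset simp: assms subset_eq less_le_trans[OF assms])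
  then obtain z where z: "z \<in> {a..b}"
      "\<And>y. y \<in> {a..b} \<Longrightarrow> deriv (deriv h) z \<le> deriv (deriv h) y"
    using continuous_attains_inf[of "{a..b}" "deriv (deriv h)"] True by auto
  show thesis
  proof (rule that)
    show "0 < deriv (deriv h) z"
      using z(1) assms by (intro deriv2_pos) auto
    fix x y assume xy: "a \<le> x" "x \<le> y" "y \<le> b"
    show "deriv (deriv h) z * (y - x) \<le> deriv h y - deriv h x"
    proof (cases "x = y")
      case False
      with xy have "x < y" by simp
      have "(deriv h has_real_derivative deriv (deriv h) t) (at t)" if "x \<le> t" for t
        using that xy assms by (intro deriv2_h) auto
      then obtain t where t: "x < t" "t < y"
          "deriv h y - deriv h x = (y - x) * deriv (deriv h) t"
        using MVT2[OF \<open>x < y\<close>, of "deriv h" "deriv (deriv h)"] by blast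
      then show ?thesis
        using z(2)[of t] xy by (simp add: mult.commute mult_left_mono)
    qed simp
  qed
next
  case False
  show thesis
    by (rule that[of 1]) (use False in auto)
qed

lemma abs_diff_le_rel_entropy:
  assumes "0 < \<epsilon>"
  obtains A where "0 \<le> A"
    "\<And>u v. 0 \<le> u \<Longrightarrow> u \<le> K \<Longrightarrow> \<bar>Dh h u\<bar> \<noteq> \<infinity> \<Longrightarrow> 0 \<le> v \<Longrightarrow>
      \<bar>v - u\<bar> \<le> \<epsilon> + A * rel_entropy h v u"
proof -
  \<comment> \<open>This interval contains every pair of points compared below:
    \<open>u + \<epsilon>/4\<close> and \<open>u + \<epsilon>/2\<close> to the right,
    \<open>u - \<epsilon>/2\<close> and \<open>u\<close> to the left.\<close>
  obtain m where m: "0 < m" "\<And>x y. \<epsilon>/4 \<le> x \<Longrightarrow> x \<le> y \<Longrightarrow> y \<le> K + \<epsilon> \<Longrightarrow>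
      m * (y - x) \<le> deriv h y - deriv h x"
    using deriv_strongly_mono[of "\<epsilon>/4" "K + \<epsilon>"] assms by auto
  \<comment> \<open>The inverse of the constant in \<open>main\<close>: a slope gap of
    \<open>m * \<epsilon> / 4\<close>, times the factor 1/2 lost in passing from the distance to
    \<open>u\<close> to the distance to \<open>w\<close>.\<close>
  define A where "A = 8 / (m * \<epsilon>)"
  have A: "0 < A" "A * (m * \<epsilon> / 8) = 1"
    using m assms by (auto simp: A_def)
  have main: "m * \<epsilon> / 8 * \<bar>v - u\<bar> \<le> rel_entropy h v u"
    if u: "0 \<le> u" "u \<le> K" "\<bar>Dh h u\<bar> \<noteq> \<infinity>" and v: "0 \<le> v" "\<bar>v - u\<bar> > \<epsilon>" for u v
  proof -
    define D where "D = real_of_ereal (Dh h u)"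
    have "0 \<le> m * \<epsilon>" using m assms by simp
    show ?thesis
    proof (cases "u \<le> v")
      case True
      \<comment> \<open>As \<open>u\<close> may be 0, the gain in slope is measured from
        \<open>u + \<epsilon>/4\<close> on; up to there monotonicity suffices.\<close>
      define w where "w = u + \<epsilon>/2"
      have "D \<le> deriv h (u + \<epsilon>/4)"
        unfolding D_def using u assms by (intro Dh_le_deriv) auto
      moreover have "m * (\<epsilon>/4) \<le> deriv h w - deriv h (u + \<epsilon>/4)"
        using m(2)[of "u + \<epsilon>/4" w] u assms by (simp add: w_def)
      ultimately have gap: "m * \<epsilon> / 4 \<le> deriv h w - D" by simp
      then have "D \<le> deriv h w" using \<open>0 \<le> m * \<epsilon>\<close> by linarith
      have "h u + D * (w - u) \<le> h w"
        unfolding D_def using u assms by (intro Dh_subgradient) (auto simp: w_def)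
      moreover have "h w + deriv h w * (v - w) \<le> h v"
        using u v assms by (intro tangent_le) (auto simp: w_def)
      \<comment> \<open>Chain the supporting line at \<open>u\<close>, evaluated at
        \<open>w\<close>, with the one at \<open>w\<close>, evaluated at \<open>v\<close>, and
        subtract \<open>D * (v - u)\<close>.\<close>
      ultimately have "(deriv h w - D) * (v - w) \<le> rel_entropy h v u"
        by (simp add: rel_entropy_def D_def[symmetric] algebra_simps)
      \<comment> \<open>Since \<open>v - u\<close> exceeds \<epsilon>, moving \<epsilon>/2 towards
        \<open>v\<close> leaves at least half of the distance.\<close>
      moreover have "m * \<epsilon> / 4 * ((v - u) / 2) \<le> (deriv h w - D) * (v - w)"
        using gap \<open>D \<le> deriv h w\<close> True v \<open>0 \<le> m * \<epsilon>\<close> assms by (intro mult_mono) (auto simp: w_def)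
      ultimately show ?thesis using True by simp
    next
      case False
      \<comment> \<open>Now \<open>u > v + \<epsilon>\<close> with \<open>v\<close> nonnegative, so
        \<open>w\<close> exceeds \<epsilon>/2 and the slope at \<open>u\<close> is an ordinary
        derivative.\<close>
      define w where "w = u - \<epsilon>/2"
      have D: "D = deriv h u"
        using False v by (simp add: D_def Dh_def)
      have "m * (\<epsilon>/2) \<le> deriv h u - deriv h w"
        using m(2)[of w u] u v False assms by (simp add: w_def)
      then have gap: "m * \<epsilon> / 4 \<le> deriv h u - deriv h w" using \<open>0 \<le> m * \<epsilon>\<close> by simp
      have "h u + deriv h u * (w - u) \<le> h w"
        using u v False assms by (intro tangent_le) (auto simp: w_def)
      moreover have "h w + deriv h w * (v - w) \<le> h v"
        using u v False assms by (intro tangent_le) (auto simp: w_def)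
      ultimately have "(deriv h u - deriv h w) * (w - v) \<le> rel_entropy h v u"
        by (simp add: rel_entropy_def D_def[symmetric] D algebra_simps)
      moreover have "m * \<epsilon> / 4 * ((u - v) / 2) \<le> (deriv h u - deriv h w) * (w - v)"
        using gap False v \<open>0 \<le> m * \<epsilon>\<close> assms by (intro mult_mono) (auto simp: w_def)
      ultimately show ?thesis using False by simp
    qed
  qed
  show thesis
  proof (rule that)
    show "0 \<le> A" using A by simp
    fix u v :: real assume uv: "0 \<le> u" "u \<le> K" "\<bar>Dh h u\<bar> \<noteq> \<infinity>" "0 \<le> v"
    show "\<bar>v - u\<bar> \<le> \<epsilon> + A * rel_entropy h v u"
    proof (cases "\<bar>v - u\<bar> > \<epsilon>")
      case True
      have "A * (m * \<epsilon> / 8 * \<bar>v - u\<bar>) \<le> A * rel_entropy h v u"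
        using main[OF uv True] A(1) by (intro mult_left_mono) auto
      then have "\<bar>v - u\<bar> \<le> A * rel_entropy h v u"
        using A(2) by (metis mult.assoc mult_1)
      then show ?thesis using assms by simp
    next
      case False
      moreover have "0 \<le> A * rel_entropy h v u"
        using A(1) rel_entropy_nonneg[of u v] uv by simp
      ultimately show ?thesis by linarith
    qed
  qed
qed

section \<open>Integrability and convergence on a finite measure space\<close>

text \<open>Clamping the argument at 0 yields a function continuous on the whole line.\<close>

lemma borel_measurable_clamped: "(\<lambda>x. h (max 0 x)) \<in> borel_measurable borel"
  by (intro borel_measurable_continuous_onI continuous_on_compose2[OF cont] continuous_intros) auto

text \<open>The terms are integrable separately: \<open>h (f x)\<close> by \<open>hf\<close>,
  \<open>h (u x)\<close> because \<open>h\<close> is bounded on [0, K], the last as a bounded factor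
  times an integrable one. This matters because the integral of a non-integrable function defaults
  to 0.\<close>

lemma integrable_rel_entropy:
  fixes f u :: "'a \<Rightarrow> real"
  assumes "finite_measure M" "complete_measure M"
    and h_nonneg: "\<And>x. 0 \<le> x \<Longrightarrow> 0 \<le> h x"
    and f: "integrable M f" "AE x in M. 0 \<le> f x"
    and hf: "(\<integral>\<^sup>+ x. ennreal (h (f x)) \<partial>M) < \<infinity>"
    and u: "u \<in> borel_measurable M" "AE x in M. 0 \<le> u x \<and> u x \<le> K"
    and Dhu: "(\<lambda>x. Dh h (u x)) \<in> borel_measurable M" "AE x in M. \<bar>Dh h (u x)\<bar> \<le> ereal C"
  shows "integrable M (\<lambda>x. rel_entropy h (f x) (u x))"
proof -
  interpret finite_measure M by fact
  interpret complete_measure M by fact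
  have fm: "f \<in> borel_measurable M" using f(1) by simp
  have m: "(\<lambda>x. h (max 0 (g x))) \<in> borel_measurable M" if "g \<in> borel_measurable M" for g
    using measurable_compose[OF that borel_measurable_clamped] .
  have "(\<integral>\<^sup>+ x. ennreal (h (max 0 (f x))) \<partial>M) = (\<integral>\<^sup>+ x. ennreal (h (f x)) \<partial>M)"
    using f(2) by (intro nn_integral_cong_AE) (auto simp: max_def)
  then have 1: "integrable M (\<lambda>x. h (max 0 (f x)))"
    using hf m[OF fm] h_nonneg by (intro integrableI_nonneg) auto
  have "bounded (h ` {0..K})"
    by (intro compact_imp_bounded compact_continuous_image continuous_on_subset[OF cont]) auto
  then obtain B where B: "\<And>x. x \<in> {0..K} \<Longrightarrow> norm (h x) \<le> B"
    unfolding bounded_iff by blast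
  have "AE x in M. norm (h (max 0 (u x))) \<le> B"
    using u(2) by eventually_elim (use B in auto)
  then have 2: "integrable M (\<lambda>x. h (max 0 (u x)))"
    by (rule integrable_const_bound) (rule m[OF u(1)])
  have u_abs: "AE x in M. norm (u x) \<le> K"
    using u(2) by eventually_elim simp
  have 3: "integrable M u"
    using u_abs u(1) by (rule integrable_const_bound)
  have 4: "integrable M (\<lambda>x. max 0 (f x) - max 0 (u x))"
    using f(1) 3 by simp
  have 5: "(\<lambda>x. Dh h (max 0 (u x))) \<in> borel_measurable M"
  proof -
    \<comment> \<open>Measurability is given for the composite with \<open>u\<close> alone, so the
      composite is overwritten by a constant on the measurable set where
      \<open>u x \<le> 0\<close>.\<close>
    have "(\<lambda>x. if u x \<le> 0 then Dh h 0 else Dh h (u x)) \<in> borel_measurable M"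
      using u(1) Dhu(1) by measurable
    moreover have "(\<lambda>x. if u x \<le> 0 then Dh h 0 else Dh h (u x)) = (\<lambda>x. Dh h (max 0 (u x)))"
      by (auto simp: max_def)
    ultimately show ?thesis by simp
  qed
  have "AE x in M. \<bar>real_of_ereal (Dh h (max 0 (u x)))\<bar> \<le> C"
    using u(2) Dhu(2)
  proof eventually_elim
    case (elim x)
    then show ?case by (cases "Dh h (u x)") (auto simp: max_def)
  qed
  then have 6: "integrable M (\<lambda>x. real_of_ereal (Dh h (max 0 (u x))) * (max 0 (f x) - max 0 (u x)))"
    using 4 5
    by (intro Bochner_Integration.integrable_bound[OF integrable_mult_right[OF 4, of C]])
       (auto elim!: eventually_mono simp: abs_mult intro!: mult_right_mono)
  have 7: "integrable M (\<lambda>x. rel_entropy h (max 0 (f x)) (max 0 (u x)))"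
    unfolding rel_entropy_def using 1 2 6 by simp
  have 8: "AE x in M. rel_entropy h (max 0 (f x)) (max 0 (u x)) = rel_entropy h (f x) (u x)"
    using f(2) u(2) by eventually_elim (simp add: max_def)
  \<comment> \<open>\<open>h\<close> is arbitrary on the negative numbers, so measurability of the unclamped function rests on
    completeness.\<close>
  have "(\<lambda>x. rel_entropy h (f x) (u x)) \<in> borel_measurable M"
    by (rule measurable_AE_eq[OF borel_measurable_integrable[OF 7] _ 8]) simp
  then show ?thesis
    using 7 8 by (intro integrable_cong_AE_imp[OF 7]) auto
qed

lemma L1_tendsto_if_rel_entropy_tendsto_0:
  fixes f :: "nat \<Rightarrow> 'a \<Rightarrow> real" and u :: "'a \<Rightarrow> real"
  assumes "finite_measure M" "complete_measure M"
    and h_nonneg: "\<And>x. 0 \<le> x \<Longrightarrow> 0 \<le> h x"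
    and f: "\<And>n. integrable M (f n)" "\<And>n. AE x in M. 0 \<le> f n x"
    and hf: "\<And>n. (\<integral>\<^sup>+ x. ennreal (h (f n x)) \<partial>M) < \<infinity>"
    and u: "u \<in> borel_measurable M" "AE x in M. 0 \<le> u x \<and> u x \<le> K"
    and Dhu: "(\<lambda>x. Dh h (u x)) \<in> borel_measurable M" "AE x in M. \<bar>Dh h (u x)\<bar> \<le> ereal C"
    and lim: "(\<lambda>n. \<integral> x. rel_entropy h (f n x) (u x) \<partial>M) \<longlonglongrightarrow> 0"
  shows "(\<lambda>n. \<integral>\<^sup>+ x. ennreal \<bar>f n x - u x\<bar> \<partial>M) \<longlonglongrightarrow> 0"
proof -
  interpret finite_measure M by fact
  define R where "R n x = rel_entropy h (f n x) (u x)" for n x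
  have R_int: "integrable M (R n)" for n
    unfolding R_def
    by (rule integrable_rel_entropy[OF assms(1,2) h_nonneg f hf u Dhu])
  have lim_R: "(\<lambda>n. \<integral> x. R n x \<partial>M) \<longlonglongrightarrow> 0"
    using lim by (simp add: R_def)
  have u_int: "integrable M u"
  proof (rule integrable_const_bound)
    show "AE x in M. norm (u x) \<le> K"
      using u(2) by eventually_elim simp
  qed (rule u(1))
  have d_int: "integrable M (\<lambda>x. \<bar>f n x - u x\<bar>)" for n
    using f(1)[of n] u_int by simp
  have "(\<lambda>n. \<integral> x. \<bar>f n x - u x\<bar> \<partial>M) \<longlonglongrightarrow> 0"
  proof (rule LIMSEQ_I)
    fix r :: real assume "0 < r"
    \<comment> \<open>Chosen so that \<epsilon> contributes at most \<open>r / 2\<close> after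
      integration; adding 1 avoids division by 0 on a null space.\<close>
    define \<epsilon> where "\<epsilon> = r / (2 * (measure M (space M) + 1))"
    have pos: "0 < measure M (space M) + 1"
      using measure_nonneg[of M "space M"] by linarith
    then have "0 < \<epsilon>"
      using \<open>0 < r\<close> by (simp add: \<epsilon>_def)
    have \<epsilon>: "\<epsilon> * measure M (space M) \<le> r / 2"
      using \<open>0 < r\<close> pos by (simp add: \<epsilon>_def field_simps)
    obtain A where A: "0 \<le> A" "\<And>u v. 0 \<le> u \<Longrightarrow> u \<le> K \<Longrightarrow> \<bar>Dh h u\<bar> \<noteq> \<infinity> \<Longrightarrow> 0 \<le> v \<Longrightarrow>
        \<bar>v - u\<bar> \<le> \<epsilon> + A * rel_entropy h v u"
      using abs_diff_le_rel_entropy[OF \<open>0 < \<epsilon>\<close>, of K] by blast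
    have bound: "(\<integral> x. \<bar>f n x - u x\<bar> \<partial>M) \<le> r / 2 + A * (\<integral> x. R n x \<partial>M)" for n
    proof -
      have "(\<integral> x. \<bar>f n x - u x\<bar> \<partial>M) \<le> (\<integral> x. \<epsilon> + A * R n x \<partial>M)"
      proof (rule integral_mono_AE[OF d_int])
        show "integrable M (\<lambda>x. \<epsilon> + A * R n x)" using R_int by simp
        show "AE x in M. \<bar>f n x - u x\<bar> \<le> \<epsilon> + A * R n x"
          using f(2)[of n] u(2) Dhu(2)
        proof eventually_elim
          case (elim x)
          then have "\<bar>Dh h (u x)\<bar> \<noteq> \<infinity>" by auto
          then show ?case using A(2)[of "u x" "f n x"] elim by (simp add: R_def)
        qed
      qed
      also have "\<dots> = \<epsilon> * measure M (space M) + A * (\<integral> x. R n x \<partial>M)"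
        using R_int by simp
      finally show ?thesis using \<epsilon> by linarith
    qed
    \<comment> \<open>\<open>A\<close> was fixed before \<open>n\<close>, so scaling by it preserves
      the limit.\<close>
    have "(\<lambda>n. A * (\<integral> x. R n x \<partial>M)) \<longlonglongrightarrow> 0"
      using tendsto_mult_left[OF lim_R, of A] by simp
    then have "\<forall>\<^sub>F n in sequentially. A * (\<integral> x. R n x \<partial>M) < r / 2"
      by (rule order_tendstoD) (use \<open>0 < r\<close> in simp)
    then obtain N where N: "\<And>n. n \<ge> N \<Longrightarrow> A * (\<integral> x. R n x \<partial>M) < r / 2"
      by (auto simp: eventually_sequentially)
    show "\<exists>N. \<forall>n\<ge>N. norm ((\<integral> x. \<bar>f n x - u x\<bar> \<partial>M) - 0) < r"
    proof (intro exI allI impI)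
      fix n assume "N \<le> n"
      have "0 \<le> (\<integral> x. \<bar>f n x - u x\<bar> \<partial>M)" by simp
      then show "norm ((\<integral> x. \<bar>f n x - u x\<bar> \<partial>M) - 0) < r"
        using bound[of n] N[OF \<open>N \<le> n\<close>] by simp
    qed
  qed
  moreover have "(\<integral>\<^sup>+ x. ennreal \<bar>f n x - u x\<bar> \<partial>M) = ennreal (\<integral> x. \<bar>f n x - u x\<bar> \<partial>M)" for n
    using d_int by (intro nn_integral_eq_integral) auto
  ultimately show ?thesis
    using tendsto_ennrealI by fastforce
qed

end

section \<open>Lebesgue measure on a bounded open set\<close>

theorem theorem2p3:
  fixes \<Omega> :: "(real ^ 'd) set"
    and h :: "real \<Rightarrow> real"
    and u\<^sub>n :: "nat \<Rightarrow> real ^ 'd \<Rightarrow> real"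
    and u :: "real ^ 'd \<Rightarrow> real"
  assumes "open \<Omega>" and "bounded \<Omega>"
    and h_nonneg: "\<And>x. 0 \<le> x \<Longrightarrow> 0 \<le> h x"
    and h_cont: "continuous_on {0..} h"
    and h_C2: "C2_on {0<..} h"
    and h_convex: "\<And>x. 0 < x \<Longrightarrow> 0 < deriv (deriv h) x"
    and h_superlinear: "filterlim (\<lambda>x. h x / x) at_top at_top"
    and h_lower: "\<exists>c>0. \<forall>x\<ge>0. c * x - c \<le> h x"
    and un_L1: "\<And>n. integrable (lebesgue_on \<Omega>) (u\<^sub>n n)"
    and un_nonneg: "\<And>n. AE x in lebesgue_on \<Omega>. 0 \<le> u\<^sub>n n x"
    and u_Linfty: "Linfty (lebesgue_on \<Omega>) (\<lambda>x. ereal (u x))"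
    and u_nonneg: "AE x in lebesgue_on \<Omega>. 0 \<le> u x"
    and Dh_u: "Linfty (lebesgue_on \<Omega>) (\<lambda>x. Dh h (u x))"
    and entropy_bound: "(SUP n. \<integral>\<^sup>+ x. ennreal (h (u\<^sub>n n x)) \<partial>lebesgue_on \<Omega>) < \<infinity>"
    and rel_entropy_lim:
      "(\<lambda>n. \<integral> x. rel_entropy h (u\<^sub>n n x) (u x) \<partial>lebesgue_on \<Omega>) \<longlonglongrightarrow> 0"
  shows "(\<lambda>n. \<integral>\<^sup>+ x. ennreal \<bar>u\<^sub>n n x - u x\<bar> \<partial>lebesgue_on \<Omega>) \<longlonglongrightarrow> 0"
proof -
  interpret entropy h
    using h_cont h_C2 h_convex by unfold_locales
  have \<Omega>: "\<Omega> \<in> lmeasurable"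
    using \<open>open \<Omega>\<close> \<open>bounded \<Omega>\<close> by (rule lmeasurable_open[rotated])
  obtain K where K: "AE x in lebesgue_on \<Omega>. \<bar>ereal (u x)\<bar> \<le> ereal K"
    using u_Linfty by (auto simp: Linfty_def)
  obtain C where C: "AE x in lebesgue_on \<Omega>. \<bar>Dh h (u x)\<bar> \<le> ereal C"
    using Dh_u by (auto simp: Linfty_def)
  show ?thesis
  proof (rule L1_tendsto_if_rel_entropy_tendsto_0[OF _ _ h_nonneg un_L1 un_nonneg _ _ _ _ C
        rel_entropy_lim])
    show "finite_measure (lebesgue_on \<Omega>)"
      using \<Omega> by (rule finite_measure_lebesgue_on)
    show "complete_measure (lebesgue_on \<Omega>)"
      using \<Omega> by (intro completion.complete_measure_restrict_space) auto
    \<comment> \<open>Each integral is at most the finite supremum over all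
      \<open>n\<close>.\<close>
    show "(\<integral>\<^sup>+ x. ennreal (h (u\<^sub>n n x)) \<partial>lebesgue_on \<Omega>) < \<infinity>" for n
      using entropy_bound by (rule le_less_trans[rotated]) (rule SUP_upper, simp)
    \<comment> \<open>\<open>Linfty\<close> speaks of extended-real functions, so the real function
      \<open>u\<close> is recovered from its embedding.\<close>
    have "(\<lambda>x. real_of_ereal (ereal (u x))) \<in> borel_measurable (lebesgue_on \<Omega>)"
      using u_Linfty unfolding Linfty_def by (intro borel_measurable_real_of_ereal) blast
    then show "u \<in> borel_measurable (lebesgue_on \<Omega>)"
      by simp
    show "AE x in lebesgue_on \<Omega>. 0 \<le> u x \<and> u x \<le> K"
      using K u_nonneg by eventually_elim auto
    show "(\<lambda>x. Dh h (u x)) \<in> borel_measurable (lebesgue_on \<Omega>)"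
      using Dh_u by (simp add: Linfty_def)
  qed
qed

end
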